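(* Let $d\ge 1$. Let $V:\mathbb{R}\to\mathbb{R}$ be continuous and nonnegative, and assume that its zero set $Z_V:=\{y\in\mathbb{R}\mid V(y)=0\}$ is an isolated point set. Let $u:\mathbb{R}^d\to\mathbb{R}$ be a bounded real-valued solution of the nonlinear equation $$\Delta u(x)=V(u(x))\,u(x),\qquad x\in\mathbb{R}^d .$$ If there exists a sequence $(r_j)_{j\ge 0}$ of real numbers increasing to $+\infty$ such that $$\int_{r_j\le |x|\le r_j+1}|u(x)|^2\,dx\to 0\quad\text{as } j\to+\infty ,$$ then $u\equiv 0$ on $\mathbb{R}^d$.
   Context: $\Delta=\sum_{i=1}^d\partial_{x_i}^2$ is the Laplacian on $\mathbb{R}^d$ and $|x|$ is the Euclidean norm. A subset $Z\subset\mathbb{R}$ is an isolated point set if every point of $Z$ is isolated in $Z$ (the empty set is allowed). Solutions are understood to be of class $C^2(\mathbb{R}^d)$, with the equation holding pointwise. *)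

theory Defs
  imports "HOL-Analysis.Analysis"
begin

definition partially_differentiable :: "'n::finite \<Rightarrow> (real ^ 'n \<Rightarrow> real) \<Rightarrow> real ^ 'n \<Rightarrow> bool" where
  "partially_differentiable i f x \<longleftrightarrow>
     (\<lambda>t. f (x + t *\<^sub>R axis i 1)) field_differentiable (at 0)"

(* Only meaningful where partially_differentiable holds: "deriv" is an
   unspecified real number at points of non-differentiability. *)
definition partial_deriv :: "'n::finite \<Rightarrow> (real ^ 'n \<Rightarrow> real) \<Rightarrow> real ^ 'n \<Rightarrow> real" where
  "partial_deriv i f x = deriv (\<lambda>t. f (x + t *\<^sub>R axis i 1)) 0"

(* Class C^2 on the whole space: all partial derivatives of order at most two,
   mixed ones included, exist everywhere and are continuous. *)
definition C2 :: "(real ^ 'n::finite \<Rightarrow> real) \<Rightarrow> bool" where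
  "C2 f \<longleftrightarrow>
     continuous_on UNIV f \<and>
     (\<forall>i. (\<forall>x. partially_differentiable i f x) \<and>
          continuous_on UNIV (partial_deriv i f) \<and>
          (\<forall>j. (\<forall>x. partially_differentiable j (partial_deriv i f) x) \<and>
               continuous_on UNIV (partial_deriv j (partial_deriv i f))))"

definition laplacian :: "(real ^ 'n::finite \<Rightarrow> real) \<Rightarrow> real ^ 'n \<Rightarrow> real" where
  "laplacian f x = (\<Sum>i\<in>UNIV. partial_deriv i (partial_deriv i f) x)"

end

theory Submission
  imports Defs
begin

text \<open>Since \<open>V \<ge> 0\<close>, we have \<open>u \<Delta>u \<ge> 0\<close>. Integrating the divergence of \<open>\<eta>\<^sup>2 u \<nabla>u\<close> for a cutoff
  \<open>\<eta>\<close> that drops from 1 to 0 across the annulus \<open>r\<^sub>j \<le> |x| \<le> r\<^sub>j + 1\<close> with a gradient bounded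
  independently of \<open>j\<close> gives the Caccioppoli inequality: \<open>\<integral>|\<nabla>u|\<^sup>2\<close> over the ball of radius \<open>r\<^sub>j\<close>
  is at most a constant times \<open>\<integral>u\<^sup>2\<close> over the annulus. Letting \<open>j \<rightarrow> \<infinity>\<close> shows \<open>\<nabla>u = 0\<close>, and a
  constant is forced to be 0 because every annulus contains a ball of radius 1/2.\<close>

section \<open>Directional derivatives and the integrals they annihilate\<close>

lemma directional_derivative_shift:
  fixes f :: "'a::real_vector \<Rightarrow> real"
  assumes "\<And>x. ((\<lambda>t. f (x + t *\<^sub>R e)) has_real_derivative D x) (at 0)"
  shows "((\<lambda>t. f (x + t *\<^sub>R e)) has_real_derivative D (x + s *\<^sub>R e)) (at s)"
proof -
  \<comment> \<open>The assumption holds at every base point, so the derivative at \<open>s\<close>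
    is the derivative at 0 along the same line restarted at
    \<open>x + s *\<^sub>R e\<close>.\<close>
  have "((\<lambda>t. f (x + (t + s) *\<^sub>R e)) has_real_derivative D (x + s *\<^sub>R e)) (at 0)"
    using assms[of "x + s *\<^sub>R e"] by (simp add: scaleR_add_left ac_simps)
  then show ?thesis
    using DERIV_shift[of "\<lambda>t. f (x + t *\<^sub>R e)" "D (x + s *\<^sub>R e)" 0 s] by simp
qed

text \<open>Turns a global bound on \<open>D\<close> into a bound on all difference quotients, which
  dominated convergence requires. The location of \<open>s\<close> is left open because the bound on
  \<open>D\<close> used later is global.\<close>

lemma directional_mvt:
  fixes f :: "'a::real_vector \<Rightarrow> real"
  assumes "\<And>x. ((\<lambda>t. f (x + t *\<^sub>R e)) has_real_derivative D x) (at 0)" and "h > 0"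
  obtains s where "f (x + h *\<^sub>R e) - f x = h * D (x + s *\<^sub>R e)"
  using MVT2[of 0 h "\<lambda>t. f (x + t *\<^sub>R e)" "\<lambda>s. D (x + s *\<^sub>R e)"]
    directional_derivative_shift[OF assms(1)] \<open>h > 0\<close> by auto

lemma integrable_compact_support:
  fixes f :: "'a::euclidean_space \<Rightarrow> real"
  assumes "continuous_on UNIV f" and "\<And>x. norm x > R \<Longrightarrow> f x = 0"
  shows "integrable lborel f"
proof -
  have "integrable lborel (\<lambda>x. indicator (cball 0 R) x *\<^sub>R f x)"
    using assms(1) by (intro borel_integrable_compact) (auto intro: continuous_on_subset)
  also have "(\<lambda>x. indicator (cball 0 R) x *\<^sub>R f x) = f"
    using assms(2) by (fastforce simp: indicator_def not_le)
  finally show ?thesis .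
qed

text \<open>By translation invariance the integrals of all difference quotients vanish, and dominated
  convergence passes this to the derivative, so that no Fubini argument is needed.\<close>
lemma integral_directional_derivative_eq_0:
  fixes f D :: "'a::euclidean_space \<Rightarrow> real"
  assumes der: "\<And>x. ((\<lambda>t. f (x + t *\<^sub>R e)) has_real_derivative D x) (at 0)"
    and cont: "continuous_on UNIV f" "continuous_on UNIV D"
    and supp: "\<And>x. norm x > R \<Longrightarrow> f x = 0" "\<And>x. norm x > R \<Longrightarrow> D x = 0"
  shows "integral\<^sup>L lborel D = 0"
proof -
  have "bounded (D ` cball 0 R)"
    using cont(2) by (intro compact_imp_bounded compact_continuous_image)
      (auto intro: continuous_on_subset)
  then obtain M where M: "M > 0" "\<And>x. norm x \<le> R \<Longrightarrow> \<bar>D x\<bar> \<le> M"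
    by (auto simp: bounded_pos)
  have bound: "\<bar>D x\<bar> \<le> M" for x
    using M supp(2)[of x] by (cases "norm x \<le> R") auto
  define F where "F n x = real (Suc n) * (f (x + (1 / real (Suc n)) *\<^sub>R e) - f x)" for n x
  have [measurable]: "f \<in> borel_measurable borel" "D \<in> borel_measurable borel"
    using cont by (auto intro: borel_measurable_continuous_onI)
  have f_int: "integrable lborel f"
    by (rule integrable_compact_support[OF cont(1) supp(1)])
  have F_int: "integral\<^sup>L lborel (F n) = 0" for n
  proof -
    define c where "c = (1 / real (Suc n)) *\<^sub>R e"
    have eq: "(\<integral>x. f (x + c) \<partial>lborel) = integral\<^sup>L lborel f"
      by (subst (2) lborel_distr_plus[of c, symmetric])
        (subst integral_distr, auto simp: add.commute)
    have "integrable (distr lborel borel ((+) c)) f"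
      using f_int by (simp add: lborel_distr_plus)
    then have "integrable lborel (\<lambda>x. f (x + c))"
      by (subst (asm) integrable_distr_eq) (auto simp: add.commute)
    then show ?thesis
      unfolding F_def c_def[symmetric] using eq f_int by simp
  qed
  have "(\<lambda>n. integral\<^sup>L lborel (F n)) \<longlonglongrightarrow> integral\<^sup>L lborel D"
  proof (rule integral_dominated_convergence)
    show "F n \<in> borel_measurable lborel" for n
      unfolding F_def by measurable
    \<comment> \<open>The dominating function lives on the radius \<open>R + norm e\<close>: the
      shifts are at most \<open>norm e\<close> long, so beyond that radius both points of the
      difference quotient lie where \<open>f\<close> vanishes.\<close>
    show "integrable lborel (\<lambda>x::'a. indicator (cball 0 (R + norm e)) x *\<^sub>R M)"
      by (intro borel_integrable_compact) auto
    have "(\<lambda>n. F n x) \<longlonglongrightarrow> D x" for x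
    proof -
      have "((\<lambda>t. (f (x + t *\<^sub>R e) - f x) / t) \<longlongrightarrow> D x) (at 0)"
        using der[of x] by (simp add: has_field_derivative_iff)
      moreover have "filterlim (\<lambda>n. 1 / real (Suc n)) (at 0) sequentially"
        using LIMSEQ_inverse_real_of_nat
        by (auto simp: filterlim_at inverse_eq_divide simp del: of_nat_Suc)
      ultimately have "(\<lambda>n. (f (x + (1 / real (Suc n)) *\<^sub>R e) - f x) / (1 / real (Suc n))) \<longlonglongrightarrow> D x"
        by (rule filterlim_compose)
      then show ?thesis
        unfolding F_def by (simp add: mult.commute)
    qed
    then show "AE x in lborel. (\<lambda>n. F n x) \<longlonglongrightarrow> D x" by simp
    have "\<bar>F n x\<bar> \<le> indicator (cball 0 (R + norm e)) x * M" for n x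
    proof (cases "norm x \<le> R + norm e")
      case True
      obtain s where "f (x + (1 / real (Suc n)) *\<^sub>R e) - f x
          = 1 / real (Suc n) * D (x + s *\<^sub>R e)"
        using directional_mvt[OF der, where h = "1 / real (Suc n)"] by auto
      then have "F n x = D (x + s *\<^sub>R e)"
        unfolding F_def by simp
      then show ?thesis using bound True by simp
    next
      case False
      define c where "c = (1 / real (Suc n)) *\<^sub>R e"
      have "norm c \<le> norm e"
        unfolding c_def using mult_left_le_one_le[of "norm e" "1 / real (Suc n)"] by simp
      then have "norm (x + c) > R"
        using False norm_triangle_ineq4[of "x + c" c] by simp
      moreover have "norm x > R"
        using False norm_ge_zero[of e] by linarith
      ultimately show ?thesis
        unfolding F_def c_def[symmetric] using supp(1) False by simp
    qed
    then show "AE x in lborel. norm (F n x) \<le> indicator (cball 0 (R + norm e)) x *\<^sub>R M" for n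
      by simp
  qed auto
  then have "(\<lambda>n. 0) \<longlonglongrightarrow> integral\<^sup>L lborel D"
    unfolding F_int .
  then show ?thesis
    by (simp add: LIMSEQ_const_iff)
qed

text \<open>The origin is joined to \<open>x\<close> by changing one coordinate at a time, and
  \<open>f\<close> is constant along each axis-parallel piece. The induction runs over the set of
  coordinates already changed.\<close>

lemma zero_axis_derivatives_imp_const:
  fixes f :: "real ^ 'n::finite \<Rightarrow> real"
  assumes "\<And>i x. ((\<lambda>t. f (x + t *\<^sub>R axis i 1)) has_real_derivative 0) (at 0)"
  shows "f x = f 0"
proof -
  have step: "f (y + t *\<^sub>R axis i 1) = f y" for y t i
    using DERIV_isconst_all[of "\<lambda>t. f (y + t *\<^sub>R axis i 1)" t 0]
      directional_derivative_shift[where D = "\<lambda>_. 0", OF assms] by simp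
  have "f (\<Sum>i\<in>S. x $ i *\<^sub>R axis i 1) = f 0" if "finite S" for S
    using that by induction (auto simp: step add.commute[of "_ *\<^sub>R _"])
  from this[OF finite[of UNIV]] show ?thesis
    using basis_expansion[of x] by (simp add: scalar_mult_eq_scaleR)
qed

lemma C2_derivatives:
  assumes "C2 f"
  shows "((\<lambda>t. f (x + t *\<^sub>R axis i 1)) has_real_derivative partial_deriv i f x) (at 0)"
    and "((\<lambda>t. partial_deriv i f (x + t *\<^sub>R axis j 1)) has_real_derivative
          partial_deriv j (partial_deriv i f) x) (at 0)"
  using assms unfolding C2_def partially_differentiable_def partial_deriv_def[of _ "partial_deriv _ _"]
    partial_deriv_def[of _ f]
  by (auto simp: field_differentiable_derivI)

section \<open>A C^1 radial cutoff with uniformly bounded gradient\<close>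

lemma max_0_square_derivative:
  "((\<lambda>t::real. (max 0 t)\<^sup>2) has_real_derivative 2 * max 0 t) (at t)"
proof -
  consider "t < 0" | "t = 0" | "t > 0" by linarith
  then show ?thesis
  proof cases
    case 1
    then have "eventually (\<lambda>s. (max 0 s)\<^sup>2 = (0::real)) (nhds t)"
      using eventually_nhds_in_open[of "{..<0}" t] by (auto elim!: eventually_mono)
    then show ?thesis
      using 1 by (subst DERIV_cong_ev[where g = "\<lambda>_. 0", OF refl _ refl]) auto
  next
    case 2
    \<comment> \<open>Squaring removes the kink of the positive part: the difference quotient at 0
      is at most |h| in size.\<close>
    have "((\<lambda>h::real. (max 0 h)\<^sup>2 / h) \<longlongrightarrow> 0) (at 0)"
    proof (rule Lim_null_comparison)
      show "\<forall>\<^sub>F h::real in at 0. norm ((max 0 h)\<^sup>2 / h) \<le> \<bar>h\<bar>"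
        by (intro always_eventually) (auto simp: max_def power2_eq_square)
    qed (auto intro!: tendsto_eq_intros)
    then show ?thesis
      using 2 by (simp add: has_field_derivative_iff)
  next
    case 3
    then have "eventually (\<lambda>s. (max 0 s)\<^sup>2 = s\<^sup>2) (nhds t)"
      using eventually_nhds_in_open[of "{0<..}" t] by (auto elim!: eventually_mono)
    then show ?thesis
      using 3 by (subst DERIV_cong_ev[where g = "\<lambda>s. s\<^sup>2", OF refl _ refl])
        (auto intro!: derivative_eq_intros)
  qed
qed

text \<open>C^1 regularity suffices, since the cutoff is differentiated only once. The bound 8 does
  not depend on \<open>\<rho>\<close>, which keeps the Caccioppoli constant uniform along the
  radii.\<close>

lemma cutoff_exists:
  fixes \<rho> :: real
  assumes "\<rho> \<ge> 0"
  obtains \<eta> :: "real ^ 'n::finite \<Rightarrow> real" and D :: "'n \<Rightarrow> real ^ 'n \<Rightarrow> real"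
  where "continuous_on UNIV \<eta>" "\<And>i. continuous_on UNIV (D i)"
    "\<And>i x. ((\<lambda>t. \<eta> (x + t *\<^sub>R axis i 1)) has_real_derivative D i x) (at 0)"
    "\<And>x. norm x \<le> \<rho> \<Longrightarrow> \<eta> x = 1" "\<And>x. norm x > \<rho> + 1 \<Longrightarrow> \<eta> x = 0"
    "\<And>i x. \<bar>D i x\<bar> \<le> 8"
    "\<And>i x. norm x < \<rho> \<or> norm x > \<rho> + 1 \<Longrightarrow> D i x = 0"
proof
  \<comment> \<open>Built from \<open>x \<bullet> x\<close> instead of \<open>norm x\<close> to be smooth at the origin too.\<close>
  define s where "s x = (x \<bullet> x - \<rho>\<^sup>2) / (2 * \<rho> + 1)" for x :: "real ^ 'n"
  \<comment> \<open>As \<open>(\<rho> + 1)\<^sup>2 - \<rho>\<^sup>2 = 2 * \<rho> + 1\<close>, the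
    function \<open>s\<close> goes from 0 on the inner sphere to 1 on the outer one. The squared
    positive part is applied twice, so that the gluing is C^1 at both spheres.\<close>
  define \<eta> where "\<eta> x = (max 0 (1 - (max 0 (s x))\<^sup>2))\<^sup>2" for x
  define D where "D i x = 2 * max 0 (1 - (max 0 (s x))\<^sup>2) *
    (- (2 * max 0 (s x) * (2 * x $ i / (2 * \<rho> + 1))))" for i x
  have s0: "s x \<le> 0" if "norm x \<le> \<rho>" for x
    using that assms power_mono[of "norm x" \<rho> 2]
    by (simp add: s_def divide_le_0_iff power2_norm_eq_inner)
  have s1: "s x \<ge> 1" if "norm x \<ge> \<rho> + 1" for x
    using that assms power_mono[of "\<rho> + 1" "norm x" 2]
    by (simp add: s_def power2_norm_eq_inner) (simp add: power2_eq_square algebra_simps)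
  have s1': "max 0 (1 - (max 0 (s x))\<^sup>2) = 0" if "norm x \<ge> \<rho> + 1" for x
    using s1[OF that] by simp
  have cont_s: "continuous_on UNIV s"
    unfolding s_def using assms by (auto intro!: continuous_intros)
  show "continuous_on UNIV \<eta>"
    unfolding \<eta>_def by (intro continuous_intros cont_s)
  show "continuous_on UNIV (D i)" for i
    unfolding D_def using assms by (intro continuous_intros cont_s) auto
  show "((\<lambda>t. \<eta> (x + t *\<^sub>R axis i 1)) has_real_derivative D i x) (at 0)" for i x
  proof -
    have eq: "s (x + t *\<^sub>R axis i 1) = (x \<bullet> x + 2 * t * x $ i + t\<^sup>2 - \<rho>\<^sup>2) / (2 * \<rho> + 1)" for t
      by (simp add: s_def inner_add_left inner_add_right inner_axis inner_axis' power2_eq_square algebra_simps)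
    have ds: "((\<lambda>t. s (x + t *\<^sub>R axis i 1)) has_real_derivative 2 * x $ i / (2 * \<rho> + 1)) (at 0)"
      unfolding eq using assms by (auto intro!: derivative_eq_intros)
    have "((\<lambda>t. 1 - (max 0 (s (x + t *\<^sub>R axis i 1)))\<^sup>2) has_real_derivative
        - (2 * max 0 (s x) * (2 * x $ i / (2 * \<rho> + 1)))) (at 0)"
      using DERIV_diff[OF DERIV_const DERIV_chain2[OF max_0_square_derivative ds]] by simp
    from DERIV_chain2[OF max_0_square_derivative this] show ?thesis
      unfolding \<eta>_def D_def by simp
  qed
  show "\<eta> x = 1" if "norm x \<le> \<rho>" for x
    using s0[OF that] by (simp add: \<eta>_def max_def)
  show "\<eta> x = 0" if "norm x > \<rho> + 1" for x
    using s1'[of x] that by (simp add: \<eta>_def)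
  show "D i x = 0" if "norm x < \<rho> \<or> norm x > \<rho> + 1" for i x
    using s0[of x] s1'[of x] that by (auto simp: D_def max_def)
  \<comment> \<open>Inside the outer sphere both positive parts are at most 1 and
    \<open>2 * x $ i / (2 * \<rho> + 1)\<close> is at most 2 in absolute value; with the two factors
    2 from the chain rule this gives 8.\<close>
  show "\<bar>D i x\<bar> \<le> 8" for i x
  proof (cases "norm x \<ge> \<rho> + 1")
    case True
    then show ?thesis using s1'[OF True] by (simp add: D_def)
  next
    case False
    have "(norm x)\<^sup>2 \<le> (\<rho> + 1)\<^sup>2"
      using False by (intro power_mono) auto
    then have "s x \<le> 1"
      using assms by (simp add: s_def power2_norm_eq_inner)
        (simp add: power2_eq_square algebra_simps)
    then have 1: "\<bar>max 0 (s x)\<bar> \<le> 1" by simp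
    have "\<bar>x $ i\<bar> \<le> \<rho> + 1"
      using component_le_norm_cart[of x i] False by linarith
    then have 2: "\<bar>2 * x $ i / (2 * \<rho> + 1)\<bar> \<le> 2"
      using assms by (simp add: abs_mult divide_simps)
    have 3: "\<bar>max 0 (1 - (max 0 (s x))\<^sup>2)\<bar> \<le> 1" by simp
    have "\<bar>D i x\<bar> = 4 * (\<bar>max 0 (1 - (max 0 (s x))\<^sup>2)\<bar> * (\<bar>max 0 (s x)\<bar> * \<bar>2 * x $ i / (2 * \<rho> + 1)\<bar>))"
      unfolding D_def abs_mult abs_minus_cancel by simp
    also have "\<dots> \<le> 4 * (1 * (1 * 2))"
      using 1 2 3 by (intro mult_left_mono mult_mono) auto
    finally show ?thesis by simp
  qed
qed

section \<open>The Caccioppoli inequality\<close>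

lemma caccioppoli:
  fixes u :: "real ^ 'n::finite \<Rightarrow> real"
  assumes "C2 u" and sub: "\<And>x. u x * laplacian u x \<ge> 0" and "\<rho> \<ge> 0"
  shows "(LINT x:cball 0 \<rho>|lborel. \<Sum>i\<in>UNIV. (partial_deriv i u x)\<^sup>2)
    \<le> 256 * CARD('n) * (LINT x:{x. \<rho> \<le> norm x \<and> norm x \<le> \<rho> + 1}|lborel. (u x)\<^sup>2)"
proof -
  obtain \<eta> :: "real ^ 'n \<Rightarrow> real" and D where
    \<eta>: "continuous_on UNIV \<eta>" "\<And>i. continuous_on UNIV (D i)"
    "\<And>i x. ((\<lambda>t. \<eta> (x + t *\<^sub>R axis i 1)) has_real_derivative D i x) (at 0)"
    "\<And>x. norm x \<le> \<rho> \<Longrightarrow> \<eta> x = 1" "\<And>x. norm x > \<rho> + 1 \<Longrightarrow> \<eta> x = 0"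
    "\<And>i x. \<bar>D i x\<bar> \<le> 8"
    "\<And>i x. norm x < \<rho> \<or> norm x > \<rho> + 1 \<Longrightarrow> D i x = 0"
    by (rule cutoff_exists[OF \<open>\<rho> \<ge> 0\<close>]) blast
  define A where "A = {x :: real ^ 'n. \<rho> \<le> norm x \<and> norm x \<le> \<rho> + 1}"
  define p where "p i = partial_deriv i u" for i
  define p2 where "p2 i = partial_deriv i (p i)" for i
  \<comment> \<open>\<open>G i\<close> is the derivative of \<open>\<eta>\<^sup>2 * u * p i\<close>
    in direction \<open>i\<close>; the sum over \<open>i\<close> is the divergence of a compactly
    supported field, so its integral is 0.\<close>
  define G where "G i x = (2 * \<eta> x * D i x) * (u x * p i x) +
    (\<eta> x)\<^sup>2 * ((p i x)\<^sup>2 + u x * p2 i x)" for i x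
  have cont: "continuous_on UNIV u" "\<And>i. continuous_on UNIV (p i)" "\<And>i. continuous_on UNIV (p2 i)"
    using \<open>C2 u\<close> unfolding C2_def p_def p2_def by auto
  have contG: "continuous_on UNIV (G i)" for i
    unfolding G_def by (intro continuous_intros cont \<eta>)
  have suppG: "G i x = 0" if "norm x > \<rho> + 1" for i x
    using \<eta>(5)[OF that] by (simp add: G_def)
  have intG: "integrable lborel (G i)" for i
    using contG suppG by (rule integrable_compact_support)
  have G0: "integral\<^sup>L lborel (G i) = 0" for i
  proof (rule integral_directional_derivative_eq_0)
    show "((\<lambda>t. (\<eta> (x + t *\<^sub>R axis i 1))\<^sup>2 * (u (x + t *\<^sub>R axis i 1) * p i (x + t *\<^sub>R axis i 1)))
        has_real_derivative G i x) (at 0)" for x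
      using \<eta>(3)[of x i] C2_derivatives(1)[OF \<open>C2 u\<close>, of x i]
        C2_derivatives(2)[OF \<open>C2 u\<close>, of i x i] unfolding p_def p2_def G_def
      by (auto intro!: derivative_eq_intros simp: algebra_simps power2_eq_square)
    show "continuous_on UNIV (\<lambda>x. (\<eta> x)\<^sup>2 * (u x * p i x))"
      by (intro continuous_intros cont \<eta>)
    show "(\<eta> x)\<^sup>2 * (u x * p i x) = 0" if "norm x > \<rho> + 1" for x
      using \<eta>(5)[OF that] by simp
  qed (use contG suppG in auto)
  have "compact A"
  proof -
    have "A = cball 0 (\<rho> + 1) - ball 0 \<rho>"
      by (auto simp: A_def)
    then show ?thesis by (simp add: compact_diff)
  qed
  then have intA: "integrable lborel (\<lambda>x. indicator A x *\<^sub>R (u x)\<^sup>2)"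
    using cont(1) by (intro borel_integrable_compact continuous_intros) (auto intro: continuous_on_subset)
  have intB: "integrable lborel (\<lambda>x. indicator (cball 0 \<rho>) x *\<^sub>R (\<Sum>i\<in>UNIV. (p i x)\<^sup>2))"
    using cont(2) by (intro borel_integrable_compact continuous_intros) (auto intro: continuous_on_subset)
  \<comment> \<open>Young's inequality, from the square of
    \<open>\<eta> * p i + 2 * D i * u\<close>: the cross term costs half of
    \<open>\<eta>\<^sup>2 * (p i)\<^sup>2\<close> plus \<open>2 * (D i)\<^sup>2 * u\<^sup>2\<close>.
    Since \<open>D i\<close> is at most 8 in size and vanishes off \<open>A\<close>, the latter is
    at most 128 times \<open>u\<^sup>2\<close> on \<open>A\<close>.\<close>
  have Gi: "G i x \<ge> (\<eta> x)\<^sup>2 * (p i x)\<^sup>2 / 2 - 128 * (indicator A x * (u x)\<^sup>2)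
      + (\<eta> x)\<^sup>2 * (u x * p2 i x)" for i x
  proof -
    have "(D i x)\<^sup>2 \<le> 64 * indicator A x"
      using \<eta>(6)[of i x] \<eta>(7)[of x i] abs_le_square_iff[of "D i x" 8]
      by (auto simp: A_def indicator_def)
    then have "(D i x)\<^sup>2 * (u x)\<^sup>2 \<le> 64 * indicator A x * (u x)\<^sup>2"
      by (intro mult_right_mono) auto
    moreover have "0 \<le> (\<eta> x * p i x + 2 * D i x * u x)\<^sup>2" by simp
    ultimately show ?thesis
      unfolding G_def by (simp add: power2_eq_square algebra_simps)
  qed
  have pw: "indicator (cball 0 \<rho>) x *\<^sub>R (\<Sum>i\<in>UNIV. (p i x)\<^sup>2)
      \<le> 2 * (\<Sum>i\<in>UNIV. G i x) + 256 * CARD('n) * (indicator A x *\<^sub>R (u x)\<^sup>2)" for x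
  proof -
    have "(\<Sum>i\<in>UNIV. (\<eta> x)\<^sup>2 * (p i x)\<^sup>2 / 2 - 128 * (indicator A x * (u x)\<^sup>2)
      + (\<eta> x)\<^sup>2 * (u x * p2 i x)) \<le> (\<Sum>i\<in>UNIV. G i x)"
      by (intro sum_mono Gi)
    moreover have "(\<Sum>i\<in>UNIV. (\<eta> x)\<^sup>2 * (u x * p2 i x)) = (\<eta> x)\<^sup>2 * (u x * laplacian u x)"
      by (simp add: laplacian_def p2_def p_def sum_distrib_left)
    moreover have "(\<eta> x)\<^sup>2 * (u x * laplacian u x) \<ge> 0"
      using sub by simp
    moreover have "(\<Sum>i\<in>UNIV. (\<eta> x)\<^sup>2 * (p i x)\<^sup>2 / 2) = (\<eta> x)\<^sup>2 * (\<Sum>i\<in>UNIV. (p i x)\<^sup>2) / 2"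
      by (simp add: sum_distrib_left sum_divide_distrib)
    moreover have "indicator (cball 0 \<rho>) x * (\<Sum>i\<in>UNIV. (p i x)\<^sup>2) \<le> (\<eta> x)\<^sup>2 * (\<Sum>i\<in>UNIV. (p i x)\<^sup>2)"
      using \<eta>(4)[of x] by (intro mult_right_mono sum_nonneg) (auto simp: indicator_def)
    ultimately show ?thesis
      by (simp add: sum.distrib sum_subtractf algebra_simps)
  qed
  have "(LINT x:cball 0 \<rho>|lborel. \<Sum>i\<in>UNIV. (p i x)\<^sup>2)
      \<le> (\<integral>x. 2 * (\<Sum>i\<in>UNIV. G i x) + 256 * CARD('n) * (indicator A x *\<^sub>R (u x)\<^sup>2) \<partial>lborel)"
    unfolding set_lebesgue_integral_def
    by (intro integral_mono pw intB Bochner_Integration.integrable_add integrable_mult_right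
        Bochner_Integration.integrable_sum intG intA)
  also have "\<dots> = 256 * CARD('n) * (LINT x:A|lborel. (u x)\<^sup>2)"
    unfolding set_lebesgue_integral_def using intG intA G0
    by (subst Bochner_Integration.integral_add)
      (auto simp: Bochner_Integration.integral_sum simp del: real_scaleR_def mult_scaleR_right)
  finally show ?thesis unfolding A_def p_def .
qed

section \<open>Lower bounds on balls, and the limit along the radii\<close>

lemma set_integral_ge_on_cball:
  fixes f :: "'a::euclidean_space \<Rightarrow> real"
  assumes "compact K" "continuous_on K f" "\<And>x. f x \<ge> 0"
    and "cball a \<delta> \<subseteq> K" "\<And>x. x \<in> cball a \<delta> \<Longrightarrow> f x \<ge> c"
  shows "c * measure lborel (cball a \<delta>) \<le> (LINT x:K|lborel. f x)"
proof -
  have "c * measure lborel (cball a \<delta>) = (\<integral>x. indicator (cball a \<delta>) x *\<^sub>R c \<partial>lborel)"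
    using emeasure_lborel_cball_finite[of a \<delta>] by simp
  also have "\<dots> \<le> (LINT x:K|lborel. f x)"
    unfolding set_lebesgue_integral_def using assms
    by (intro integral_mono borel_integrable_compact) (auto simp: indicator_def)
  finally show ?thesis .
qed

theorem theorem2p3:
  fixes V :: "real \<Rightarrow> real"
    and u :: "real ^ 'n::finite \<Rightarrow> real"
    and r :: "nat \<Rightarrow> real"
  assumes V_cont: "continuous_on UNIV V"
    and V_nonneg: "\<And>y. V y \<ge> 0"
    and V_zeros: "discrete {y. V y = 0}"
    and u_bounded: "bounded (range u)"
    and u_C2: "C2 u"
    and u_eq: "\<And>x. laplacian u x = V (u x) * u x"
    and r_incr: "incseq r"
    and r_top: "filterlim r at_top sequentially"
    and annuli: "(\<lambda>j. LINT x:{x. r j \<le> norm x \<and> norm x \<le> r j + 1}|lborel. \<bar>u x\<bar>\<^sup>2)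
                   \<longlonglongrightarrow> 0"
  shows "\<forall>x. u x = 0"
proof -
  define f where "f x = (\<Sum>i\<in>UNIV. (partial_deriv i u x)\<^sup>2)" for x
  define A where "A j = (LINT x:{x. r j \<le> norm x \<and> norm x \<le> r j + 1}|lborel. (u x)\<^sup>2)" for j
  have A0: "A \<longlonglongrightarrow> 0"
    using annuli unfolding A_def by simp
  have u_cont: "continuous_on UNIV u"
    using u_C2 by (simp add: C2_def)
  \<comment> \<open>The equation and the sign of \<open>V\<close> enter here: the product is V(u)
    times the square of \<open>u\<close>.\<close>
  have sub: "u x * laplacian u x \<ge> 0" for x
    using V_nonneg[of "u x"] mult_nonneg_nonneg[of "V (u x)" "u x * u x"] by (simp add: u_eq mult.left_commute)
  have f_cont: "continuous_on UNIV f"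
    using u_C2 unfolding f_def C2_def by (intro continuous_intros) auto
  have f_nonneg: "f x \<ge> 0" for x
    unfolding f_def by (intro sum_nonneg) auto
  \<comment> \<open>A positive value persists above \<open>f a / 2\<close> on a small ball. Once
    that ball lies in the ball of radius \<open>r j\<close>, the energy there has a fixed positive
    lower bound, whereas the Caccioppoli bound tends to 0.\<close>
  have f0: "f a = 0" for a
  proof (rule ccontr)
    assume "f a \<noteq> 0"
    then have pos: "f a > 0" using f_nonneg[of a] by linarith
    have "open {x. f a / 2 < f x}"
      using f_cont by (intro open_Collect_less continuous_intros)
    then obtain \<delta> where \<delta>: "\<delta> > 0" "cball a \<delta> \<subseteq> {x. f a / 2 < f x}"
      using pos unfolding open_contains_cball by fastforce
    have ev: "\<forall>\<^sub>F j in sequentially. f a / 2 * measure lborel (cball a \<delta>) \<le> 256 * CARD('n) * A j"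
      \<comment> \<open>This threshold puts the small ball inside the ball of radius
        \<open>r j\<close> and also makes \<open>r j\<close> nonnegative, which early radii may fail
        to be.\<close>
      using filterlim_at_top_ge[of r sequentially "norm a + \<delta>", THEN iffD1, OF r_top, rule_format,
          OF order_refl]
    proof eventually_elim
      case (elim j)
      have "norm x \<le> r j" if "x \<in> cball a \<delta>" for x
        using that elim norm_triangle_ineq2[of x a] by (auto simp: dist_norm norm_minus_commute)
      then have "f a / 2 * measure lborel (cball a \<delta>) \<le> (LINT x:cball 0 (r j)|lborel. f x)"
        using \<delta> f_nonneg f_cont
        by (intro set_integral_ge_on_cball) (force intro: continuous_on_subset)+
      also have "\<dots> \<le> 256 * CARD('n) * A j"
        unfolding f_def A_def
      proof (rule caccioppoli[OF u_C2 sub])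
        show "0 \<le> r j"
          using elim \<delta>(1) norm_ge_zero[of a] by linarith
      qed
      finally show ?case .
    qed
    have "(\<lambda>j. 256 * CARD('n) * A j) \<longlonglongrightarrow> 0"
      using tendsto_mult_right_zero[OF A0] by simp
    from tendsto_lowerbound[OF this ev] have "f a / 2 * measure lborel (cball a \<delta>) \<le> 0"
      by simp
    moreover have "measure lborel (cball a \<delta>) > 0"
      using \<delta>(1) by (rule content_cball_pos)
    ultimately show False
      using pos by (simp add: mult_le_0_iff)
  qed
  have "partial_deriv i u x = 0" for i x
    using f0[of x] by (simp add: f_def sum_nonneg_eq_0_iff)
  then have const: "u x = u 0" for x
    using C2_derivatives(1)[OF u_C2] by (intro zero_axis_derivatives_imp_const) metis
  have "\<forall>\<^sub>F j in sequentially. (u 0)\<^sup>2 * measure lborel (cball (0 :: real ^ 'n) (1/2)) \<le> A j"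
    using filterlim_at_top_ge[of r sequentially 0, THEN iffD1, OF r_top, rule_format, OF order_refl]
  proof eventually_elim
    case (elim j)
    \<comment> \<open>A point on the middle sphere of the annulus, at distance 1/2 from both
      boundary spheres; any coordinate axis serves, hence \<open>undefined\<close>.\<close>
    define b where "b = (r j + 1/2) *\<^sub>R (axis undefined 1 :: real ^ 'n)"
    have b: "norm b = r j + 1/2"
      using elim by (simp add: b_def norm_axis_1)
    have "{x :: real ^ 'n. r j \<le> norm x \<and> norm x \<le> r j + 1} = cball 0 (r j + 1) - ball 0 (r j)"
      by auto
    then have "compact {x :: real ^ 'n. r j \<le> norm x \<and> norm x \<le> r j + 1}"
      by (simp add: compact_diff)
    moreover have "cball b (1/2) \<subseteq> {x. r j \<le> norm x \<and> norm x \<le> r j + 1}"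
    proof
      fix x assume "x \<in> cball b (1/2)"
      then show "x \<in> {x. r j \<le> norm x \<and> norm x \<le> r j + 1}"
        using b norm_triangle_ineq3[of b x] by (auto simp: dist_norm abs_le_iff)
    qed
    ultimately have "(u 0)\<^sup>2 * measure lborel (cball b (1/2)) \<le> A j"
      unfolding A_def using u_cont
      by (intro set_integral_ge_on_cball continuous_intros)
        (auto intro: continuous_on_subset eq_refl[OF arg_cong[OF const[symmetric]]])
    \<comment> \<open>The volume of a ball does not depend on its centre, so the lower bound is the
      same for every \<open>j\<close> although \<open>b\<close> moves.\<close>
    then show ?case
      by (simp add: content_cball)
  qed
  then have "(u 0)\<^sup>2 * measure lborel (cball (0 :: real ^ 'n) (1/2)) \<le> 0"
    using A0 by (intro tendsto_lowerbound) auto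
  moreover have "measure lborel (cball (0 :: real ^ 'n) (1/2)) > 0"
    by (rule content_cball_pos) simp
  ultimately have "u 0 = 0"
    by (simp add: mult_le_0_iff)
  then show ?thesis
    using const by simp
qed

end
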